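(* Let $m\ge 1$, $\lambda\in\mathbb{C}\setminus\{0\}$, and let $\mathcal{H}^m_\lambda$ be the complex Hom-Lie algebra with basis $(x_1,\dots,x_m,y_1,\dots,y_m,z)$, with brackets $[x_i,y_j]=\delta_{ij}z=-[y_j,x_i]$ and all other brackets of basis vectors zero, and with twisting map $\alpha$ whose matrix in this basis is $\begin{bmatrix}X&0&0\\0&Y&0\\0&0&\lambda\end{bmatrix}$, where $X,Y\in M_m(\mathbb{C})$ and ${}^tX\,Y=\lambda I_m$. Let $F$ be a complex vector space with basis $(v_1,\dots,v_{m+2})$, let $\beta\in\mathrm{End}(F)$ have matrix $$\begin{bmatrix}Y&0&0\\0&\lambda&0\\0&0&1\end{bmatrix}$$ in this basis (blocks of sizes $m,1,1$), and let $[\cdot,\cdot]_F:\mathcal{H}^m_\lambda\times F\to F$ be the bilinear map given, for $1\le i\le m$ and $1\le j\le m+2$, by $$[x_i,v_j]_F=\delta_{i,j}v_{m+1},\qquad [y_i,v_j]_F=\delta_{j,m+2}\,\beta(v_i),\qquad [z,v_j]_F=\delta_{j,m+2}\,\lambda v_{m+1}.$$ Then $\rho:\mathcal{H}^m_\lambda\to\mathrm{End}(F)$, $\rho(x)=[x,\cdot]_F$, is a faithful representation of $\mathcal{H}^m_\lambda$ (i.e. $(F,[\cdot,\cdot]_F,\beta)$ is a faithful representation).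
   Context: Matrices of linear maps act on column vectors (columns are images of basis vectors). A Hom-Lie algebra is a triple $(\mathcal{G},[\cdot,\cdot],\alpha)$ with $[\cdot,\cdot]$ a skew-symmetric bilinear map on the vector space $\mathcal{G}$ and $\alpha:\mathcal{G}\to\mathcal{G}$ linear, such that $[\alpha(x),[y,w]]+[\alpha(y),[w,x]]+[\alpha(w),[x,y]]=0$ for all $x,y,w$. It is multiplicative if $\alpha([x,y])=[\alpha(x),\alpha(y)]$. A representation of a multiplicative Hom-Lie algebra $(\mathcal{G},[\cdot,\cdot],\alpha)$ is a triple $(V,[\cdot,\cdot]_V,\beta)$ with $V$ a vector space, $\beta:V\to V$ linear, and $[\cdot,\cdot]_V:\mathcal{G}\times V\to V$ bilinear, such that for all $x,y\in\mathcal{G}$, $v\in V$: $[\alpha(x),\beta(v)]_V=\beta([x,v]_V)$ and $[[x,y],\beta(v)]_V=[\alpha(x),[y,v]_V]_V-[\alpha(y),[x,v]_V]_V$. It is faithful if $\beta$ is an isomorphism and the map $\mathcal{G}\to\mathrm{End}(V)$, $x\mapsto[x,\cdot]_V$, is injective. *)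

theory Defs
  imports Complex_Main "Jordan_Normal_Form.Matrix"
begin

text \<open>
  A vector space is a type together with a scalar multiplication satisfying the
  locale \<open>vector_space\<close>. Ordered bases are lists, so basis vectors and
  matrix entries are both indexed from 0.
\<close>

context vector_space
begin

definition ordered_basis :: "'b list \<Rightarrow> bool" where
  "ordered_basis bs \<longleftrightarrow> distinct bs \<and> independent (set bs) \<and> span (set bs) = UNIV"

text \<open>Column \<open>j\<close> holds the coordinates of the image of the \<open>j\<close>-th basis vector.\<close>

definition has_matrix :: "('b \<Rightarrow> 'b) \<Rightarrow> 'b list \<Rightarrow> 'a mat \<Rightarrow> bool" where
  "has_matrix f bs A \<longleftrightarrow>
     A \<in> carrier_mat (length bs) (length bs) \<and>
     (\<forall>j<length bs. f (bs ! j) = (\<Sum>i<length bs. scale (A $$ (i, j)) (bs ! i)))"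

end

definition bilinear_map ::
  "('k::field \<Rightarrow> 'a::ab_group_add \<Rightarrow> 'a) \<Rightarrow> ('k \<Rightarrow> 'b::ab_group_add \<Rightarrow> 'b) \<Rightarrow>
   ('k \<Rightarrow> 'c::ab_group_add \<Rightarrow> 'c) \<Rightarrow> ('a \<Rightarrow> 'b \<Rightarrow> 'c) \<Rightarrow> bool" where
  "bilinear_map s1 s2 s3 f \<longleftrightarrow>
     (\<forall>x. Vector_Spaces.linear s2 s3 (f x)) \<and> (\<forall>y. Vector_Spaces.linear s1 s3 (\<lambda>x. f x y))"

locale hom_lie_algebra = vector_space scale
  for scale :: "'k::field \<Rightarrow> 'g::ab_group_add \<Rightarrow> 'g" +
  fixes brk :: "'g \<Rightarrow> 'g \<Rightarrow> 'g" and \<alpha> :: "'g \<Rightarrow> 'g"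
  assumes brk_bilinear: "bilinear_map scale scale scale brk"
    and brk_skew: "brk x y = - brk y x"
    and twist_linear: "Vector_Spaces.linear scale scale \<alpha>"
    and hom_jacobi: "brk (\<alpha> x) (brk y w) + brk (\<alpha> y) (brk w x) + brk (\<alpha> w) (brk x y) = 0"

locale multiplicative_hom_lie_algebra = hom_lie_algebra +
  assumes twist_brk: "\<alpha> (brk x y) = brk (\<alpha> x) (\<alpha> y)"

locale hom_lie_representation =
  multiplicative_hom_lie_algebra scale brk \<alpha> + V: vector_space scaleV
  for scale :: "'k::field \<Rightarrow> 'g::ab_group_add \<Rightarrow> 'g" and brk :: "'g \<Rightarrow> 'g \<Rightarrow> 'g" and \<alpha> :: "'g \<Rightarrow> 'g"
    and scaleV :: "'k \<Rightarrow> 'v::ab_group_add \<Rightarrow> 'v" +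
  fixes act :: "'g \<Rightarrow> 'v \<Rightarrow> 'v" and \<beta> :: "'v \<Rightarrow> 'v"
  assumes act_bilinear: "bilinear_map scale scaleV scaleV act"
    and rep_twist_linear: "Vector_Spaces.linear scaleV scaleV \<beta>"
    and act_twist: "act (\<alpha> x) (\<beta> v) = \<beta> (act x v)"
    and act_brk: "act (brk x y) (\<beta> v) = act (\<alpha> x) (act y v) - act (\<alpha> y) (act x v)"

locale faithful_hom_lie_representation = hom_lie_representation +
  assumes rep_twist_bij: "bij \<beta>"
    and act_inj: "inj act"

end

theory Submission
  imports Defs "Jordan_Normal_Form.Determinant"
begin

text \<open>
  Every identity is multilinear, so it suffices to check it on basis vectors; the only
  nontrivial cases reduce to \<open>transpose X * Y = \<lambda> I\<close>. Since brackets lie in the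
  span of the central element \<open>z\<close>, each term of the Hom-Jacobi identity vanishes.
  The matrix \<open>Y\<close> is invertible with inverse \<open>\<lambda>\<inverse> transpose X\<close>, so
  \<open>\<beta>\<close> is bijective. If \<open>u = \<Sum> a\<^sub>i x\<^sub>i + \<Sum> b\<^sub>i y\<^sub>i + c z\<close> acts as zero,
  evaluating at \<open>v\<^sub>j\<close> gives \<open>a\<^sub>j = 0\<close>, and evaluating at the last
  basis vector gives \<open>\<beta> (\<Sum> b\<^sub>i v\<^sub>i + c v\<^bsub>m+1\<^esub>) = 0\<close>, whence all \<open>b\<^sub>i\<close> and \<open>c\<close> vanish.
\<close>

text \<open>Plain equations for each argument: in this form the simplifier can prove that composites
  of linear and bilinear maps are bilinear.\<close>

lemma bilinear_map_iff:
  "bilinear_map s1 s2 s3 f \<longleftrightarrow>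
     vector_space s1 \<and> vector_space s2 \<and> vector_space s3 \<and>
     (\<forall>x y y'. f x (y + y') = f x y + f x y') \<and> (\<forall>x c y. f x (s2 c y) = s3 c (f x y)) \<and>
     (\<forall>x x' y. f (x + x') y = f x y + f x' y) \<and> (\<forall>c x y. f (s1 c x) y = s3 c (f x y))"
  unfolding bilinear_map_def Vector_Spaces.linear_iff by auto

lemma bilinear_map_zero:
  assumes "vector_space s1" "vector_space s2" "vector_space s3"
  shows "bilinear_map s1 s2 s3 (\<lambda>x y. 0)"
proof -
  interpret vector_space s3 by fact
  show ?thesis using assms by (simp add: bilinear_map_iff)
qed

lemma (in vector_space) linear_eq_on_ordered_basis:
  assumes bs: "ordered_basis bs"
    and f: "Vector_Spaces.linear scale s2 f" and g: "Vector_Spaces.linear scale s2 g"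
    and eq: "\<And>b. b \<in> set bs \<Longrightarrow> f b = g b"
  shows "f x = g x"
proof -
  interpret vector_space_pair scale s2
    using f by (simp add: Vector_Spaces.linear_iff vector_space_pair_def)
  show ?thesis
    using linear_eq_on[OF f g _ eq, of x "set bs"] bs by (simp add: ordered_basis_def)
qed

text \<open>Linearity is applied twice: with a basis vector fixed on the left the right argument
  becomes arbitrary, and then the left one does. This reduces the identities below to finite case
  checks.\<close>

lemma bilinear_eq_on_ordered_bases:
  assumes bs: "vector_space.ordered_basis s1 bs" and cs: "vector_space.ordered_basis s2 cs"
    and f: "bilinear_map s1 s2 s3 f" and g: "bilinear_map s1 s2 s3 g"
    and eq: "\<And>b c. b \<in> set bs \<Longrightarrow> c \<in> set cs \<Longrightarrow> f b c = g b c"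
  shows "f x y = g x y"
proof -
  interpret A: vector_space s1 using f by (simp add: bilinear_map_iff)
  interpret B: vector_space s2 using f by (simp add: bilinear_map_iff)
  have "f b y = g b y" if "b \<in> set bs" for b
    using B.linear_eq_on_ordered_basis[OF cs, of s3 "f b" "g b" y] f g eq that
    by (simp add: bilinear_map_def)
  then show ?thesis
    using A.linear_eq_on_ordered_basis[OF bs, of s3 "\<lambda>x. f x y" "\<lambda>x. g x y" x] f g
    by (simp add: bilinear_map_def)
qed

text \<open>The span of a finite set yields coefficients indexed by vectors; distinctness makes
  \<open>(!) bs\<close> a bijection, which turns them into coefficients indexed by
  positions.\<close>

lemma (in vector_space) ordered_basis_expansion:
  assumes "ordered_basis bs"
  obtains c where "u = (\<Sum>i<length bs. scale (c i) (bs ! i))"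
proof -
  have "u \<in> range (\<lambda>r. \<Sum>v\<in>set bs. scale (r v) v)"
    using assms span_finite[of "set bs"] by (simp add: ordered_basis_def)
  then obtain r where "u = (\<Sum>v\<in>set bs. scale (r v) v)" by blast
  also have "\<dots> = (\<Sum>i<length bs. scale (r (bs ! i)) (bs ! i))"
    using assms by (intro sum.reindex_bij_betw[symmetric] bij_betw_nth)
      (auto simp: ordered_basis_def)
  finally show thesis by (rule that)
qed

lemma (in vector_space) ordered_basis_coeff_zero:
  assumes bs: "ordered_basis bs" and 0: "(\<Sum>i<length bs. scale (c i) (bs ! i)) = 0"
    and j: "j < length bs"
  shows "c j = 0"
proof -
  \<comment> \<open>Independence speaks of coefficients attached to vectors, so \<open>c\<close> is
    transported along the inverse of the indexing bijection.\<close>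
  define r where "r v = c (the_inv_into {..<length bs} ((!) bs) v)" for v
  have bij: "bij_betw ((!) bs) {..<length bs} (set bs)"
    using bs by (intro bij_betw_nth) (auto simp: ordered_basis_def)
  then have r: "r (bs ! i) = c i" if "i < length bs" for i
    using that by (simp add: r_def bij_betw_def the_inv_into_f_f)
  have "(\<Sum>v\<in>set bs. scale (r v) v) = 0"
    using 0 by (simp add: sum.reindex_bij_betw[OF bij, symmetric] r)
  then have "r (bs ! j) = 0"
    using independentD[of "set bs" "set bs" r "bs ! j"] bs j by (simp add: ordered_basis_def)
  then show ?thesis using r j by simp
qed

lemma sum_lessThan_add:
  fixes f :: "nat \<Rightarrow> 'a::comm_monoid_add"
  shows "(\<Sum>i<m + n. f i) = (\<Sum>i<m. f i) + (\<Sum>i<n. f (m + i))"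
  by (induction n) (simp_all add: add.assoc)

text \<open>Peels off one diagonal block. The condition on \<open>A\<close> makes the block boundary
  fall exactly between \<open>as\<close> and \<open>bs\<close>, so the off-diagonal zero blocks
  remove the mixed terms; iterating reaches every block.\<close>

lemma (in vector_space) has_matrix_diag_block:
  assumes f: "has_matrix f (as @ bs) (diag_block_mat (A # As))"
    and A: "A \<in> carrier_mat (length as) (length as)"
  shows "has_matrix f as A" and "has_matrix f bs (diag_block_mat As)"
proof -
  define B where "B = diag_block_mat As"
  define M where
    "M = four_block_mat A (0\<^sub>m (dim_row A) (dim_col B)) (0\<^sub>m (dim_row B) (dim_col A)) B"
  have dims: "dim_row A = length as" "dim_col A = length as" using A by auto
  have f': "has_matrix f (as @ bs) M" using f by (simp add: M_def B_def Let_def)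
  then have B: "B \<in> carrier_mat (length bs) (length bs)"
    using dims unfolding has_matrix_def carrier_mat_def M_def by simp
  have img: "f ((as @ bs) ! j) =
      (\<Sum>i<length as + length bs. scale (M $$ (i, j)) ((as @ bs) ! i))"
    if "j < length as + length bs" for j
    using f' that unfolding has_matrix_def by simp
  have "f (as ! j) = (\<Sum>i<length as. scale (A $$ (i, j)) (as ! i))" if "j < length as" for j
    using img[of j] that B dims by (simp add: M_def sum_lessThan_add nth_append)
  with A show "has_matrix f as A" by (simp add: has_matrix_def)
  have "f (bs ! j) = (\<Sum>i<length bs. scale (B $$ (i, j)) (bs ! i))" if "j < length bs" for j
    using img[of "length as + j"] that B dims by (simp add: M_def sum_lessThan_add nth_append)
  with B show "has_matrix f bs (diag_block_mat As)"
    by (cases "bs = []") (simp_all add: has_matrix_def B_def)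
qed

text \<open>The range is a subspace containing a basis, so \<open>f\<close> is onto, and in finite
  dimension a surjective endomorphism is injective.\<close>

lemma (in vector_space) bij_if_basis_in_range:
  assumes bs: "ordered_basis bs" and f: "Vector_Spaces.linear scale scale f"
    and sub: "set bs \<subseteq> range f"
  shows "bij f"
proof -
  interpret F: finite_dimensional_vector_space scale "set bs"
    using bs by unfold_locales (auto simp: ordered_basis_def)
  interpret f: Vector_Spaces.linear scale scale f by (fact f)
  have "span (set bs) \<subseteq> range f"
    using sub by (intro span_minimal f.subspace_image) auto
  then have "surj f" using bs by (auto simp: ordered_basis_def)
  then show ?thesis using F.linear_surj_imp_inj[OF f] by (simp add: bij_def)
qed

theorem theorem5p5:
  fixes m :: nat and lam :: complex and X Y :: "complex mat"
    and scaleH :: "complex \<Rightarrow> 'h::ab_group_add \<Rightarrow> 'h"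
    and xs ys :: "'h list" and z :: 'h
    and brk :: "'h \<Rightarrow> 'h \<Rightarrow> 'h" and \<alpha> :: "'h \<Rightarrow> 'h"
    and scaleF :: "complex \<Rightarrow> 'f::ab_group_add \<Rightarrow> 'f"
    and vs :: "'f list" and \<beta> :: "'f \<Rightarrow> 'f" and act :: "'h \<Rightarrow> 'f \<Rightarrow> 'f"
  assumes "m \<ge> 1" and "lam \<noteq> 0"
    and "X \<in> carrier_mat m m" and "Y \<in> carrier_mat m m"
    and "transpose_mat X * Y = lam \<cdot>\<^sub>m 1\<^sub>m m"
    and "vector_space scaleH"
    and "length xs = m" and "length ys = m"
    and "vector_space.ordered_basis scaleH (xs @ ys @ [z])"
    and "bilinear_map scaleH scaleH scaleH brk"
    and "\<And>i j. i < m \<Longrightarrow> j < m \<Longrightarrow> brk (xs ! i) (ys ! j) = (if i = j then z else 0)"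
    and "\<And>i j. i < m \<Longrightarrow> j < m \<Longrightarrow> brk (ys ! j) (xs ! i) = - (if i = j then z else 0)"
    and "\<And>i j. i < m \<Longrightarrow> j < m \<Longrightarrow> brk (xs ! i) (xs ! j) = 0"
    and "\<And>i j. i < m \<Longrightarrow> j < m \<Longrightarrow> brk (ys ! i) (ys ! j) = 0"
    and "\<And>i. i < m \<Longrightarrow> brk (xs ! i) z = 0" and "\<And>i. i < m \<Longrightarrow> brk z (xs ! i) = 0"
    and "\<And>i. i < m \<Longrightarrow> brk (ys ! i) z = 0" and "\<And>i. i < m \<Longrightarrow> brk z (ys ! i) = 0"
    and "brk z z = 0"
    and "Vector_Spaces.linear scaleH scaleH \<alpha>"
    and "vector_space.has_matrix scaleH \<alpha> (xs @ ys @ [z])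
           (diag_block_mat [X, Y, lam \<cdot>\<^sub>m 1\<^sub>m 1])"
    and "vector_space scaleF"
    and "length vs = m + 2"
    and "vector_space.ordered_basis scaleF vs"
    and "Vector_Spaces.linear scaleF scaleF \<beta>"
    and "vector_space.has_matrix scaleF \<beta> vs (diag_block_mat [Y, lam \<cdot>\<^sub>m 1\<^sub>m 1, 1\<^sub>m 1])"
    and "bilinear_map scaleH scaleF scaleF act"
    and "\<And>i j. i < m \<Longrightarrow> j < m + 2 \<Longrightarrow> act (xs ! i) (vs ! j) = (if i = j then vs ! m else 0)"
    and "\<And>i j. i < m \<Longrightarrow> j < m + 2 \<Longrightarrow>
           act (ys ! i) (vs ! j) = (if j = m + 1 then \<beta> (vs ! i) else 0)"
    and "\<And>j. j < m + 2 \<Longrightarrow>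
           act z (vs ! j) = (if j = m + 1 then scaleF lam (vs ! m) else 0)"
  shows "faithful_hom_lie_representation scaleH brk \<alpha> scaleF act \<beta>"
proof -
  interpret H: vector_space scaleH by fact
  interpret F: vector_space scaleF by fact
  interpret a: Vector_Spaces.linear scaleH scaleH \<alpha> by fact
  interpret b: Vector_Spaces.linear scaleF scaleF \<beta> by fact
  \<comment> \<open>Each argument of \<open>brk\<close> and \<open>act\<close> gets its own
    linear-map interpretation, with the other argument as a parameter; the resulting rules are
    collected in \<open>lin\<close>.\<close>
  interpret brkL: Vector_Spaces.linear scaleH scaleH "\<lambda>x. brk x y" for y
    using assms(10) by (simp add: bilinear_map_def)
  interpret brkR: Vector_Spaces.linear scaleH scaleH "brk x" for x
    using assms(10) by (simp add: bilinear_map_def)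
  interpret actL: Vector_Spaces.linear scaleH scaleF "\<lambda>x. act x v" for v
    using assms(27) by (simp add: bilinear_map_def)
  interpret actR: Vector_Spaces.linear scaleF scaleF "act x" for x
    using assms(27) by (simp add: bilinear_map_def)
  note basisH = assms(9) and basisF = assms(24)
  note X = assms(3) and Y = assms(4) and len = assms(7,8,23)
  note brk_basis = assms(11-19)
  note lin = a.add a.scale a.neg a.diff a.zero b.add b.scale b.neg b.diff b.zero
    brkL.add brkL.scale brkL.neg brkL.diff brkL.zero brkR.add brkR.scale brkR.neg brkR.diff brkR.zero
    actL.add actL.scale actL.neg actL.diff actL.zero actR.add actR.scale actR.neg actR.diff actR.zero

  have casesH: "(\<exists>i<m. u = xs ! i) \<or> (\<exists>i<m. u = ys ! i) \<or> u = z"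
    if "u \<in> set (xs @ ys @ [z])" for u
    using that len by (auto simp: in_set_conv_nth)
  have casesF: "(\<exists>j<m. v = vs ! j) \<or> v = vs ! m \<or> v = vs ! (m + 1)" if "v \<in> set vs" for v
    using that len less_Suc_eq by (auto simp: in_set_conv_nth)
  \<comment> \<open>Indices start at 0, so \<open>vs ! m\<close> and \<open>vs ! (m + 1)\<close> are
    the last two basis vectors; the split matches the block sizes \<open>m\<close>, 1, 1 of the
    matrix of \<open>\<beta>\<close>.\<close>
  have vs_split: "vs = take m vs @ [vs ! m] @ [vs ! (m + 1)]"
    using len by (intro nth_equalityI) (auto simp: nth_append less_Suc_eq)

  \<comment> \<open>Values of the twisting maps on basis vectors\<close>
  have aX: "H.has_matrix \<alpha> xs X"
    and aYz: "H.has_matrix \<alpha> (ys @ [z]) (diag_block_mat [Y, lam \<cdot>\<^sub>m 1\<^sub>m 1])"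
    using H.has_matrix_diag_block[OF assms(21)] X len by simp_all
  have aY: "H.has_matrix \<alpha> ys Y" and az': "H.has_matrix \<alpha> [z] (diag_block_mat [lam \<cdot>\<^sub>m 1\<^sub>m 1])"
    using H.has_matrix_diag_block[OF aYz] Y len by simp_all
  have ax: "\<alpha> (xs ! j) = (\<Sum>i<m. scaleH (X $$ (i, j)) (xs ! i))" if "j < m" for j
    using aX that len by (simp add: H.has_matrix_def)
  have ay: "\<alpha> (ys ! j) = (\<Sum>i<m. scaleH (Y $$ (i, j)) (ys ! i))" if "j < m" for j
    using aY that len by (simp add: H.has_matrix_def)
  have az: "\<alpha> z = scaleH lam z"
    using az' unfolding diag_block_mat_singleton by (simp add: H.has_matrix_def)

  have beta: "F.has_matrix \<beta> (take m vs @ [vs ! m] @ [vs ! (m + 1)])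
      (diag_block_mat [Y, lam \<cdot>\<^sub>m 1\<^sub>m 1, 1\<^sub>m 1])"
    using assms(26) vs_split by simp
  have bY: "F.has_matrix \<beta> (take m vs) Y"
    and bt: "F.has_matrix \<beta> ([vs ! m] @ [vs ! (m + 1)]) (diag_block_mat [lam \<cdot>\<^sub>m 1\<^sub>m 1, 1\<^sub>m 1])"
    using F.has_matrix_diag_block[OF beta] Y len by simp_all
  have bm': "F.has_matrix \<beta> [vs ! m] (lam \<cdot>\<^sub>m 1\<^sub>m 1)"
    and be': "F.has_matrix \<beta> [vs ! (m + 1)] (diag_block_mat [1\<^sub>m 1])"
    using F.has_matrix_diag_block[OF bt] by simp_all
  have bv: "\<beta> (vs ! j) = (\<Sum>i<m. scaleF (Y $$ (i, j)) (vs ! i))" if "j < m" for j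
    using bY that len by (simp add: F.has_matrix_def)
  have bm: "\<beta> (vs ! m) = scaleF lam (vs ! m)"
    using bm' by (simp add: F.has_matrix_def)
  have be: "\<beta> (vs ! (m + 1)) = vs ! (m + 1)"
    using be' unfolding diag_block_mat_singleton by (simp add: F.has_matrix_def)

  \<comment> \<open>Entrywise forms of the relation between \<open>X\<close> and
    \<open>Y\<close>\<close>
  have XtY: "(\<Sum>k<m. X $$ (k, i) * Y $$ (k, j)) = (if i = j then lam else 0)"
    if "i < m" "j < m" for i j
  proof -
    have "(transpose_mat X * Y) $$ (i, j) = (lam \<cdot>\<^sub>m 1\<^sub>m m) $$ (i, j)" using assms(5) by simp
    then show ?thesis using that X Y by (simp add: scalar_prod_def lessThan_atLeast0)
  qed
  \<comment> \<open>A left inverse of a square matrix is also a right inverse, so the product may be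
    taken in the other order after dividing by \<open>lam\<close>.\<close>
  have YXt: "(\<Sum>k<m. Y $$ (i, k) * X $$ (j, k)) = (if i = j then lam else 0)"
    if "i < m" "j < m" for i j
  proof -
    have Xt: "transpose_mat X \<in> carrier_mat m m" using X by simp
    have "(inverse lam \<cdot>\<^sub>m transpose_mat X) * Y = inverse lam \<cdot>\<^sub>m (transpose_mat X * Y)"
      by (rule mult_smult_assoc_mat[OF Xt Y])
    also have "\<dots> = 1\<^sub>m m"
      unfolding assms(5) using assms(2) by (intro eq_matI) auto
    finally have "Y * (inverse lam \<cdot>\<^sub>m transpose_mat X) = 1\<^sub>m m"
      by (rule mat_mult_left_right_inverse[OF smult_carrier_mat[OF Xt] Y])
    then have "inverse lam \<cdot>\<^sub>m (Y * transpose_mat X) = 1\<^sub>m m"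
      unfolding mult_smult_distrib[OF Y Xt] .
    then have "(inverse lam \<cdot>\<^sub>m (Y * transpose_mat X)) $$ (i, j) = 1\<^sub>m m $$ (i, j)" by simp
    then have "inverse lam * (\<Sum>k<m. Y $$ (i, k) * X $$ (j, k)) = (if i = j then 1 else 0)"
      using that X Y by (simp add: scalar_prod_def lessThan_atLeast0)
    then show ?thesis using assms(2) by (auto simp: field_simps split: if_splits)
  qed

  \<comment> \<open>The multiplicative Hom-Lie algebra structure\<close>
  have brk_z: "brk u z = 0" for u
  proof (rule H.linear_eq_on_ordered_basis[OF basisH,
      where f = "\<lambda>u. brk u z" and g = "\<lambda>u. 0"])
    show "Vector_Spaces.linear scaleH scaleH (\<lambda>u. brk u z)" 
      by (simp add: Vector_Spaces.linear_iff H.vector_space_axioms lin)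
    show "Vector_Spaces.linear scaleH scaleH (\<lambda>u. 0)"
      by (simp add: Vector_Spaces.linear_iff H.vector_space_axioms)
    show "brk u z = 0" if "u \<in> set (xs @ ys @ [z])" for u
      using casesH[OF that] by (auto simp: brk_basis)
  qed
  have brk_brk: "brk u (brk x y) = 0" for u x y
  proof (rule bilinear_eq_on_ordered_bases[OF basisH basisH,
      where f = "\<lambda>x y. brk u (brk x y)" and g = "\<lambda>x y. 0"])
    show "bilinear_map scaleH scaleH scaleH (\<lambda>x y. brk u (brk x y))"
      by (simp add: bilinear_map_iff H.vector_space_axioms lin)
    show "bilinear_map scaleH scaleH scaleH (\<lambda>x y. 0)"
      by (intro bilinear_map_zero H.vector_space_axioms)
    show "brk u (brk x y) = 0" if "x \<in> set (xs @ ys @ [z])" "y \<in> set (xs @ ys @ [z])" for x y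
      using that[THEN casesH] by (auto simp: brk_basis brk_z lin)
  qed
  have skew: "brk x y = - brk y x" for x y
  proof (rule bilinear_eq_on_ordered_bases[OF basisH basisH,
      where f = "brk" and g = "\<lambda>x y. - brk y x"])
    show "bilinear_map scaleH scaleH scaleH brk" by fact
    show "bilinear_map scaleH scaleH scaleH (\<lambda>x y. - brk y x)"
      by (simp add: bilinear_map_iff H.vector_space_axioms lin H.scale_minus_right)
    show "brk x y = - brk y x" if "x \<in> set (xs @ ys @ [z])" "y \<in> set (xs @ ys @ [z])" for x y
      using that[THEN casesH] by (auto simp: brk_basis)
  qed
  \<comment> \<open>In the double sum only the terms with \<open>k = l\<close> survive; what remains
    is the \<open>(i, j)\<close> entry of \<open>transpose_mat X * Y\<close> times
    \<open>z\<close>.\<close>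
  have brk_axay: "brk (\<alpha> (xs ! i)) (\<alpha> (ys ! j)) = (if i = j then scaleH lam z else 0)"
    if "i < m" "j < m" for i j
  proof -
    have "brk (\<alpha> (xs ! i)) (\<alpha> (ys ! j)) =
        (\<Sum>l<m. \<Sum>k<m. scaleH (X $$ (k, i) * Y $$ (l, j)) (brk (xs ! k) (ys ! l)))"
      using that by (simp add: ax ay brkL.sum brkR.sum lin H.scale_sum_right mult.commute)
    also have "\<dots> = (\<Sum>k<m. scaleH (X $$ (k, i) * Y $$ (k, j)) z)"
      by (intro sum.cong refl) (simp add: brk_basis if_distrib[of "scaleH _"] cong: if_cong)
    also have "\<dots> = scaleH (if i = j then lam else 0) z"
      using that by (simp add: XtY H.scale_sum_left[symmetric])
    finally show ?thesis by simp
  qed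
  have brk_alpha_zero: "brk (\<alpha> (xs ! i)) (\<alpha> (xs ! j)) = 0" "brk (\<alpha> (ys ! i)) (\<alpha> (ys ! j)) = 0"
    if "i < m" "j < m" for i j
    using that by (simp_all add: ax ay brkL.sum brkR.sum lin brk_basis)
  have twist: "\<alpha> (brk x y) = brk (\<alpha> x) (\<alpha> y)" for x y
  proof (rule bilinear_eq_on_ordered_bases[OF basisH basisH,
      where f = "\<lambda>x y. \<alpha> (brk x y)" and g = "\<lambda>x y. brk (\<alpha> x) (\<alpha> y)"])
    show "bilinear_map scaleH scaleH scaleH (\<lambda>x y. \<alpha> (brk x y))"
      "bilinear_map scaleH scaleH scaleH (\<lambda>x y. brk (\<alpha> x) (\<alpha> y))"
      by (simp_all add: bilinear_map_iff H.vector_space_axioms lin)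
    have zr: "brk z u = 0" for u using skew[of z u] brk_z by simp
    have yx: "brk (\<alpha> (ys ! j)) (\<alpha> (xs ! i)) = - (if i = j then scaleH lam z else 0)"
      if "i < m" "j < m" for i j
      using that skew[of "\<alpha> (ys ! j)" "\<alpha> (xs ! i)"] brk_axay by simp
    show "\<alpha> (brk x y) = brk (\<alpha> x) (\<alpha> y)"
      if "x \<in> set (xs @ ys @ [z])" "y \<in> set (xs @ ys @ [z])" for x y
      using that[THEN casesH]
      by (auto simp: brk_basis brk_z zr az brk_axay yx brk_alpha_zero lin)
  qed

  \<comment> \<open>The representation identities\<close>
  have act_x: "act (xs ! i) (vs ! j) = (if i = j then vs ! m else 0)"
    "act (ys ! i) (vs ! j) = 0" if "i < m" "j < m" for i j
    using that assms(28,29) by simp_all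
  have act_m: "act (xs ! i) (vs ! m) = 0" "act (ys ! i) (vs ! m) = 0"
    if "i < m" for i
    using that assms(28,29) by simp_all
  have act_e: "act (xs ! i) (vs ! (m + 1)) = 0" "act (ys ! i) (vs ! (m + 1)) = \<beta> (vs ! i)"
    if "i < m" for i
    using that assms(28,29) by simp_all
  \<comment> \<open>Some clauses of \<open>act_z\<close> and \<open>aact_y\<close> carry a premise
    \<open>j < m\<close> although \<open>j\<close> does not occur in their equation;
    \<open>0 < m\<close> gives the simplifier a witness.\<close>
  have m0: "0 < m" using assms(1) by simp
  have act_z: "act z (vs ! j) = 0" "act z (vs ! m) = 0" "act z (vs ! (m + 1)) = scaleF lam (vs ! m)"
    if "j < m" for j
    using that assms(30) by simp_all

  \<comment> \<open>Here and below \<open>[simplified]\<close> turns \<open>m + 1\<close> into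
    \<open>Suc m\<close>, the form that the simplifier produces in goals.\<close>
  have aact_x: "act (\<alpha> (xs ! i)) (vs ! m) = 0" "act (\<alpha> (xs ! i)) (vs ! (m + 1)) = 0"
    if "i < m" for i
    using that by (simp_all add: ax actL.sum lin act_m act_e[simplified])
  have aact_y: "act (\<alpha> (ys ! i)) (vs ! j) = 0" "act (\<alpha> (ys ! i)) (vs ! m) = 0"
    "act (\<alpha> (ys ! i)) (vs ! (m + 1)) = \<beta> (\<beta> (vs ! i))"
    if "i < m" "j < m" for i j
    using that by (simp_all add: ay bv[of i] b.sum actL.sum lin act_x act_m act_e[simplified])
  \<comment> \<open>\<open>\<beta>\<close> preserves the span of the first \<open>m\<close> vectors
    of \<open>vs\<close>, and \<open>ys ! i\<close>, \<open>z\<close> and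
    \<open>\<alpha> (ys ! i)\<close> all vanish there.\<close>
  have act_b: "act (ys ! i) (\<beta> (vs ! j)) = 0" "act z (\<beta> (vs ! j)) = 0"
    "act (\<alpha> (ys ! i)) (\<beta> (vs ! j)) = 0"
    if "i < m" "j < m" for i j
    using that by (simp_all add: bv actR.sum lin act_x act_z aact_y)
  have aact_xb: "act (\<alpha> (xs ! i)) (\<beta> (vs ! j)) = (if i = j then scaleF lam (vs ! m) else 0)"
    if "i < m" "j < m" for i j
  proof -
    have "act (\<alpha> (xs ! i)) (\<beta> (vs ! j)) =
        (\<Sum>l<m. \<Sum>k<m. scaleF (X $$ (k, i) * Y $$ (l, j)) (act (xs ! k) (vs ! l)))"
      using that by (simp add: ax bv actL.sum actR.sum lin F.scale_sum_right mult.commute)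
    also have "\<dots> = (\<Sum>k<m. scaleF (X $$ (k, i) * Y $$ (k, j)) (vs ! m))"
      by (intro sum.cong refl) (simp add: act_x if_distrib[of "scaleF _"] cong: if_cong)
    also have "\<dots> = scaleF (if i = j then lam else 0) (vs ! m)"
      using that by (simp add: XtY F.scale_sum_left[symmetric])
    finally show ?thesis by simp
  qed

  \<comment> \<open>The nonzero cases are \<open>xs ! i\<close> on \<open>vs ! i\<close>, where both
    sides are \<open>lam\<close> times \<open>vs ! m\<close>, and \<open>ys ! i\<close> or
    \<open>z\<close> on the last vector, where they are \<open>\<beta> (\<beta> (vs ! i))\<close> or
    \<open>lam\<close> squared times \<open>vs ! m\<close>.\<close>
  have act_twist: "act (\<alpha> x) (\<beta> v) = \<beta> (act x v)" for x v
  proof (rule bilinear_eq_on_ordered_bases[OF basisH basisF,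
      where f = "\<lambda>x v. act (\<alpha> x) (\<beta> v)" and g = "\<lambda>x v. \<beta> (act x v)"])
    show "bilinear_map scaleH scaleF scaleF (\<lambda>x v. act (\<alpha> x) (\<beta> v))"
      "bilinear_map scaleH scaleF scaleF (\<lambda>x v. \<beta> (act x v))"
      by (simp_all add: bilinear_map_iff H.vector_space_axioms F.vector_space_axioms lin)
    show "act (\<alpha> x) (\<beta> v) = \<beta> (act x v)"
      if "x \<in> set (xs @ ys @ [z])" "v \<in> set vs" for x v
      using casesH[OF that(1)] casesF[OF that(2)] m0
      by (auto simp: act_x act_m act_e[simplified] act_z[simplified] aact_x[simplified]
          aact_y[simplified] act_b aact_xb az bm be[simplified] lin)
  qed

  \<comment> \<open>First \<open>x\<close> and \<open>y\<close> are reduced to basis vectors for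
    fixed \<open>v\<close>, then \<open>v\<close> is. The essential case is \<open>xs ! i\<close>,
    \<open>ys ! i\<close> on the last vector, where \<open>aact_xb\<close> matches the action of
    \<open>z\<close>.\<close>
  have act_brk: "act (brk x y) (\<beta> v) = act (\<alpha> x) (act y v) - act (\<alpha> y) (act x v)" for x y v
  proof (rule bilinear_eq_on_ordered_bases[OF basisH basisH,
      where f = "\<lambda>x y. act (brk x y) (\<beta> v)" and g = "\<lambda>x y. act (\<alpha> x) (act y v) - act (\<alpha> y) (act x v)"])
    show "bilinear_map scaleH scaleH scaleF (\<lambda>x y. act (brk x y) (\<beta> v))"
      by (simp add: bilinear_map_iff H.vector_space_axioms F.vector_space_axioms lin)
    show "bilinear_map scaleH scaleH scaleF (\<lambda>x y. act (\<alpha> x) (act y v) - act (\<alpha> y) (act x v))"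
      by (simp add: bilinear_map_iff H.vector_space_axioms F.vector_space_axioms lin
          F.scale_right_diff_distrib)
    fix x y assume xy: "x \<in> set (xs @ ys @ [z])" "y \<in> set (xs @ ys @ [z])"
    show "act (brk x y) (\<beta> v) = act (\<alpha> x) (act y v) - act (\<alpha> y) (act x v)"
    proof (rule F.linear_eq_on_ordered_basis[OF basisF,
      where f = "\<lambda>v. act (brk x y) (\<beta> v)" and g = "\<lambda>v. act (\<alpha> x) (act y v) - act (\<alpha> y) (act x v)"])
      show "Vector_Spaces.linear scaleF scaleF (\<lambda>v. act (brk x y) (\<beta> v))"
        "Vector_Spaces.linear scaleF scaleF (\<lambda>v. act (\<alpha> x) (act y v) - act (\<alpha> y) (act x v))"
        by (simp_all add: Vector_Spaces.linear_iff F.vector_space_axioms lin F.scale_right_diff_distrib)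
      show "act (brk x y) (\<beta> v) = act (\<alpha> x) (act y v) - act (\<alpha> y) (act x v)"
        if "v \<in> set vs" for v
        using xy[THEN casesH] casesF[OF that] m0
        by (auto simp: act_x act_m act_e[simplified] act_z[simplified] aact_x[simplified]
            aact_y[simplified] act_b aact_xb az bm be[simplified] brk_basis lin)
    qed
  qed

  \<comment> \<open>Faithfulness\<close>
  have bij: "bij \<beta>"
  proof (rule F.bij_if_basis_in_range[OF basisF assms(25)], rule subsetI)
    fix v assume "v \<in> set vs"
    then consider j where "j < m" "v = vs ! j" | "v = vs ! m" | "v = vs ! (m + 1)"
      using casesF by blast
    then show "v \<in> range \<beta>"
    proof cases
      case 1
      \<comment> \<open>The coefficients are row \<open>j\<close> of \<open>X\<close>, that is,
        column \<open>j\<close> of its transpose; by \<open>YXt\<close> the image is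
        \<open>lam\<close> times \<open>vs ! j\<close>.\<close>
      have "\<beta> (\<Sum>i<m. scaleF (X $$ (j, i)) (vs ! i)) =
          (\<Sum>i<m. \<Sum>k<m. scaleF (Y $$ (k, i) * X $$ (j, i)) (vs ! k))"
        by (simp add: b.sum lin bv F.scale_sum_right mult.commute)
      also have "\<dots> = (\<Sum>k<m. scaleF (\<Sum>i<m. Y $$ (k, i) * X $$ (j, i)) (vs ! k))"
        by (subst sum.swap) (simp add: F.scale_sum_left)
      also have "\<dots> = (\<Sum>k<m. if k = j then scaleF lam (vs ! k) else 0)"
        using 1 by (intro sum.cong refl) (simp add: YXt)
      also have "\<dots> = scaleF lam v" using 1 by simp
      finally have "v = \<beta> (scaleF (inverse lam) (\<Sum>i<m. scaleF (X $$ (j, i)) (vs ! i)))"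
        using assms(2) by (simp add: b.scale)
      then show ?thesis by blast
    next
      case 2
      then have "v = \<beta> (scaleF (inverse lam) v)" using bm assms(2) by (simp add: b.scale)
      then show ?thesis by blast
    next
      case 3
      then show ?thesis using be by (metis rangeI)
    qed
  qed

  have ker: "u = 0" if u: "act u = (\<lambda>_. 0)" for u
  proof -
    obtain c where "u = (\<Sum>k<length (xs @ ys @ [z]). scaleH (c k) ((xs @ ys @ [z]) ! k))"
      by (rule H.ordered_basis_expansion[OF basisH])
    moreover have "length (xs @ ys @ [z]) = m + (m + 1)" using len by simp
    ultimately have u_eq: "u = (\<Sum>i<m. scaleH (c i) (xs ! i)) +
        ((\<Sum>i<m. scaleH (c (m + i)) (ys ! i)) + scaleH (c (m + m)) z)"
      using len by (simp only: sum_lessThan_add) (simp add: nth_append)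
    have vm: "vs ! m \<noteq> 0"
      using basisF len F.dependent_zero[of "set vs"]
      by (metis F.ordered_basis_def less_add_same_cancel1 nth_mem zero_less_numeral)
    \<comment> \<open>On \<open>vs ! j\<close> only \<open>xs ! j\<close> acts nontrivially, so the
      value isolates \<open>c j\<close>.\<close>
    have c1: "c j = 0" if "j < m" for j
    proof -
      have "act u (vs ! j) = (\<Sum>i<m. scaleF (c i) (if i = j then vs ! m else 0))"
        using that m0 by (simp add: u_eq lin actL.sum act_x act_z)
      also have "\<dots> = scaleF (c j) (vs ! m)"
        using that by (simp add: if_distrib[of "scaleF _"] cong: if_cong)
      finally show ?thesis using u vm by simp
    qed
    \<comment> \<open>Coefficients of the preimage under \<open>\<beta>\<close> of
      \<open>act u (vs ! (m + 1))\<close>: those of \<open>ys\<close> and \<open>z\<close>, shifted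
      down by \<open>m\<close>. The default 0 at index \<open>m + 1\<close> extends the sum to all
      of \<open>vs\<close>.\<close>
    define d where "d i = (if i \<le> m then c (m + i) else 0)" for i
    have "act u (vs ! (m + 1)) =
        \<beta> ((\<Sum>i<m. scaleF (c (m + i)) (vs ! i)) + scaleF (c (m + m)) (vs ! m))"
      using m0 by (simp add: u_eq lin actL.sum b.sum act_e[simplified] act_z[simplified] bm)
    also have "(\<Sum>i<m. scaleF (c (m + i)) (vs ! i)) + scaleF (c (m + m)) (vs ! m) =
        (\<Sum>i<length vs. scaleF (d i) (vs ! i))"
      using len by (simp add: d_def)
    finally have "\<beta> (\<Sum>i<length vs. scaleF (d i) (vs ! i)) = \<beta> 0"
      using u by (simp add: b.zero)
    then have "(\<Sum>i<length vs. scaleF (d i) (vs ! i)) = 0"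
      using bij by (meson bij_def injD)
    then have "d i = 0" if "i \<le> m" for i
      using F.ordered_basis_coeff_zero[OF basisF] len that by simp
    then have "c (m + i) = 0" if "i \<le> m" for i
      using that unfolding d_def by metis
    with c1 show ?thesis by (simp add: u_eq)
  qed
  have inj: "inj act"
  proof (rule injI)
    fix x y assume "act x = act y"
    then have "act (x - y) = (\<lambda>_. 0)" by (simp add: fun_eq_iff actL.diff)
    then show "x = y" using ker by fastforce
  qed

  show ?thesis
    by unfold_locales
      (rule assms(10,20,25,27) skew twist act_twist act_brk bij inj | simp add: brk_brk)+
qed

end
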